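(* Let $d\ge 1$, let $\mathcal{L}_v,\mathcal{L}_t:\mathbb{R}^d\to\mathbb{R}$ be functions (the image-generation loss and the text-generation loss) of a shared parameter vector $\theta$, with $\mathcal{L}_v$ twice continuously differentiable and $\mathcal{L}_t$ differentiable. Fix $\theta\in\mathbb{R}^d$ and put $g_v=\nabla_\theta\mathcal{L}_v(\theta)$, $g_t=\nabla_\theta\mathcal{L}_t(\theta)$, and $H_v=\nabla^2_\theta\mathcal{L}_v(\theta)$ (the Hessian of $\mathcal{L}_v$ at $\theta$). For $\eta>0$, the gradient step $\theta\mapsto\theta-\eta g_t$ changes the visual loss by $$\Delta\mathcal{L}_v=\mathcal{L}_v(\theta-\eta g_t)-\mathcal{L}_v(\theta)=-\eta\,\langle g_t,g_v\rangle+\frac{\eta^2}{2}\,g_t^\top H_v g_t+o(\eta^2)\qquad(\eta\to 0^+).$$ Hence, if $\langle g_t,g_v\rangle<0$, then for all sufficiently small $\eta>0$ the step increases the visual loss, i.e. $\mathcal{L}_v(\theta-\eta g_t)>\mathcal{L}_v(\theta)$.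
   Context: $\langle\cdot,\cdot\rangle$ is the standard Euclidean inner product on $\mathbb{R}^d$. The gradients $g_v$ and $g_t$ are said to be conflicting (modality gradient conflict) if $\langle g_v,g_t\rangle<0$. The notation $o(\eta^2)$ denotes a quantity $r(\eta)$ with $r(\eta)/\eta^2\to 0$ as $\eta\to 0^+$. *)

theory Defs
  imports "HOL-Analysis.Analysis"
begin

definition gradient :: "('a::real_inner \<Rightarrow> real) \<Rightarrow> 'a \<Rightarrow> 'a"
  where "gradient f x = (THE D. GDERIV f x :> D)"

lemma gradient_eqI:
  assumes "GDERIV f x :> D"
  shows "gradient f x = D"
  unfolding gradient_def
proof (rule the_equality, rule assms)
  fix D' assume "GDERIV f x :> D'"
  then have "(\<lambda>h. inner h D') = (\<lambda>h. inner h D)"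
    using assms has_derivative_unique unfolding gderiv_def by blast
  then have "inner h D' = inner h D" for h by metis
  then show "D' = D" by (metis inner_commute vector_eq_rdot)
qed

lemma GDERIV_gradient:
  fixes f :: "'a::euclidean_space \<Rightarrow> real"
  assumes "f differentiable (at x)"
  shows "GDERIV f x :> gradient f x"
proof -
  obtain f' where f': "(f has_derivative f') (at x)"
    using assms unfolding differentiable_def by blast
  then interpret linear f' by (rule has_derivative_linear)
  have "GDERIV f x :> adjoint f' 1"
    using f' adjoint_works[OF linear_axioms, of _ 1] by (simp add: gderiv_def)
  then show ?thesis by (metis gradient_eqI)
qed

text \<open>The Hessian is the Jacobian matrix of the gradient map, so its \<open>(i, j)\<close> entry is
  the second partial derivative \<open>\<partial>\<^sub>j (\<partial>\<^sub>i f)\<close>.\<close>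

definition hessian :: "(real ^ 'n \<Rightarrow> real) \<Rightarrow> real ^ 'n \<Rightarrow> real ^ 'n ^ 'n"
  where "hessian f x = jacobian (gradient f) (at x)"

text \<open>Both differentiability conditions are needed explicitly, as \<^const>\<open>gradient\<close> and
  \<^const>\<open>hessian\<close> are total functions with unspecified values at points where the
  derivatives do not exist.\<close>

definition twice_continuously_differentiable :: "(real ^ 'n \<Rightarrow> real) \<Rightarrow> bool"
  where "twice_continuously_differentiable f \<longleftrightarrow>
    (\<forall>x. f differentiable (at x)) \<and>
    (\<forall>x. gradient f differentiable (at x)) \<and>
    continuous_on UNIV (hessian f)"

end

theory Submission
  imports Defs
begin

text \<open>
  Restricted to the ray of the step, the visual loss becomes the function
  \<open>\<phi> \<eta> = L\<^sub>v (\<theta> - \<eta> *\<^sub>R g\<^sub>t)\<close> of one real variable, and both claims concern \<open>\<phi>\<close> at \<open>0\<close>: the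
  expansion is Taylor's formula with Peano remainder (l'Hopital applied once, then the
  definition of the second derivative), and the increase is \<open>\<phi>' 0 = - (g\<^sub>t \<bullet> g\<^sub>v) > 0\<close>.
\<close>

text \<open>L'Hopital trades the remainder over \<open>h\<^sup>2\<close> for
  \<open>(f' (x + h) - f' x - h * c) / (2 * h)\<close>, whose limit comes from the derivative of
  \<open>f'\<close> at \<open>x\<close>. A second use of l'Hopital would ask for \<open>f'\<close>
  to be differentiable near \<open>x\<close>, whereas this is assumed only at \<open>x\<close>
  itself.\<close>

lemma taylor2_peano:
  fixes f f' :: "real \<Rightarrow> real"
  assumes f: "\<forall>\<^sub>F y in nhds x. (f has_real_derivative f' y) (at y)"
    and f': "(f' has_real_derivative c) (at x)"
  shows "((\<lambda>h. (f (x + h) - f x - h * f' x - h\<^sup>2 / 2 * c) / h\<^sup>2) \<longlongrightarrow> 0) (at 0)"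
proof (rule lhopital)
  have shift: "filterlim (\<lambda>h. x + h) (nhds x) (at 0)"
    by (auto intro!: tendsto_eq_intros)
  \<comment> \<open>A property that holds eventually in \<open>nhds x\<close> also holds at
    \<open>x\<close>, so \<open>f\<close> is differentiable there.\<close>
  have "isCont f x"
    using eventually_nhds_x_imp_x[OF f] by (rule DERIV_isCont)
  then have "((\<lambda>h. f (x + h)) \<longlongrightarrow> f x) (at 0)"
    by (simp add: isCont_iff)
  then show "((\<lambda>h. f (x + h) - f x - h * f' x - h\<^sup>2 / 2 * c) \<longlongrightarrow> 0) (at 0)"
    by (auto intro!: tendsto_eq_intros)
  show "((\<lambda>h::real. h\<^sup>2) \<longlongrightarrow> 0) (at 0)"
    by (auto intro!: tendsto_eq_intros)
  show "\<forall>\<^sub>F h::real in at 0. h\<^sup>2 \<noteq> 0" "\<forall>\<^sub>F h::real in at 0. 2 * h \<noteq> 0"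
    by (auto simp: eventually_at_filter)
  show "\<forall>\<^sub>F h in at 0. ((\<lambda>h. f (x + h) - f x - h * f' x - h\<^sup>2 / 2 * c) has_real_derivative
      f' (x + h) - f' x - h * c) (at h)"
    using eventually_compose_filterlim[OF f shift]
  proof eventually_elim
    case (elim h)
    then have "((\<lambda>h. f (x + h)) has_real_derivative f' (x + h)) (at h)"
      by (simp add: DERIV_shift add.commute)
    then show ?case
      by (auto intro!: derivative_eq_intros)
  qed
  show "\<forall>\<^sub>F h in at 0. ((\<lambda>h::real. h\<^sup>2) has_real_derivative 2 * h) (at h)"
    by (auto intro!: derivative_eq_intros always_eventually)
  \<comment> \<open>The difference quotient of \<open>f'\<close> tends to \<open>c\<close>, so the
    limit is \<open>(c - c) / 2\<close>; for nonzero \<open>h\<close> this is the quotient of the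
    two derivatives.\<close>
  have "((\<lambda>h. ((f' (x + h) - f' x) / h - c) / 2) \<longlongrightarrow> 0) (at 0)"
    using tendsto_divide[OF tendsto_diff[OF f'[unfolded DERIV_def] tendsto_const[of c]]
        tendsto_const[of 2]] by simp
  moreover have "\<forall>\<^sub>F h in at 0. ((f' (x + h) - f' x) / h - c) / 2
      = (f' (x + h) - f' x - h * c) / (2 * h)"
    by (auto simp: eventually_at_filter field_simps)
  ultimately show "((\<lambda>h. (f' (x + h) - f' x - h * c) / (2 * h)) \<longlongrightarrow> 0) (at 0)"
    by (rule Lim_transform_eventually)
qed

lemma GDERIV_along_line:
  assumes "GDERIV f (x + t *\<^sub>R v) :> D"
  shows "((\<lambda>s. f (x + s *\<^sub>R v)) has_real_derivative v \<bullet> D) (at t)"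
proof -
  have "((\<lambda>s. x + s *\<^sub>R v) has_derivative (\<lambda>s. s *\<^sub>R v)) (at t)"
    by (auto intro!: derivative_eq_intros)
  from diff_chain_at[OF this assms[unfolded gderiv_def]] show ?thesis
    by (simp add: o_def has_field_derivative_def mult.commute[of _ "v \<bullet> D"])
qed

text \<open>The Hessian is the derivative of the gradient map, and the chain rule evaluates it in
  the direction \<open>v\<close>. Pairing with a fixed \<open>w\<close> makes the function
  real-valued; for differentiable \<open>f\<close>, the choice \<open>w = v\<close> yields the
  second derivative of \<open>f\<close> along the line.\<close>

lemma inner_gradient_along_line:
  assumes "gradient f differentiable (at (x + t *\<^sub>R v))"
  shows "((\<lambda>s. w \<bullet> gradient f (x + s *\<^sub>R v)) has_real_derivative
    w \<bullet> (hessian f (x + t *\<^sub>R v) *v v)) (at t)"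
proof -
  have line: "((\<lambda>s. x + s *\<^sub>R v) has_derivative (\<lambda>s. s *\<^sub>R v)) (at t)"
    by (auto intro!: derivative_eq_intros)
  have "(gradient f has_derivative (*v) (hessian f (x + t *\<^sub>R v))) (at (x + t *\<^sub>R v))"
    using assms unfolding hessian_def by (simp add: jacobian_works)
  from has_derivative_inner_right[OF diff_chain_at[OF line this], of w] show ?thesis
    by (simp add: o_def has_field_derivative_def matrix_vector_mult_scaleR
        mult.commute[of _ "w \<bullet> _"])
qed

theorem proposition1:
  fixes L\<^sub>v L\<^sub>t :: "real ^ 'n \<Rightarrow> real"
    and \<theta> g\<^sub>v g\<^sub>t :: "real ^ 'n"
    and H\<^sub>v :: "real ^ 'n ^ 'n"
  assumes "twice_continuously_differentiable L\<^sub>v"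
    and "\<forall>x. L\<^sub>t differentiable (at x)"
    and "g\<^sub>v = gradient L\<^sub>v \<theta>"
    and "g\<^sub>t = gradient L\<^sub>t \<theta>"
    and "H\<^sub>v = hessian L\<^sub>v \<theta>"
  shows "(\<exists>r :: real \<Rightarrow> real.
            (\<forall>\<eta>>0. L\<^sub>v (\<theta> - \<eta> *\<^sub>R g\<^sub>t) - L\<^sub>v \<theta>
                = - \<eta> * (g\<^sub>t \<bullet> g\<^sub>v) + \<eta>\<^sup>2 / 2 * (g\<^sub>t \<bullet> (H\<^sub>v *v g\<^sub>t)) + r \<eta>) \<and>
            ((\<lambda>\<eta>. r \<eta> / \<eta>\<^sup>2) \<longlongrightarrow> 0) (at_right 0)) \<and>
         (g\<^sub>t \<bullet> g\<^sub>v < 0 \<longrightarrow>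
            (\<forall>\<^sub>F \<eta> in at_right 0. L\<^sub>v (\<theta> - \<eta> *\<^sub>R g\<^sub>t) > L\<^sub>v \<theta>))"
proof -
  have diff: "L\<^sub>v differentiable (at x)" "gradient L\<^sub>v differentiable (at x)" for x
    using assms(1) by (auto simp: twice_continuously_differentiable_def)
  define \<phi> where "\<phi> \<eta> = L\<^sub>v (\<theta> + \<eta> *\<^sub>R (- g\<^sub>t))" for \<eta>
  define \<phi>' where "\<phi>' \<eta> = (- g\<^sub>t) \<bullet> gradient L\<^sub>v (\<theta> + \<eta> *\<^sub>R (- g\<^sub>t))" for \<eta>
  define c where "c = g\<^sub>t \<bullet> (H\<^sub>v *v g\<^sub>t)"
  \<comment> \<open>Taking \<open>r\<close> to be the exact remainder makes the expansion an
    identity for every \<open>\<eta>\<close>; only its decay is left to prove.\<close>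
  define r where "r \<eta> = \<phi> \<eta> - \<phi> 0 - \<eta> * \<phi>' 0 - \<eta>\<^sup>2 / 2 * c" for \<eta>
  have \<phi>: "(\<phi> has_real_derivative \<phi>' \<eta>) (at \<eta>)" for \<eta>
    unfolding \<phi>_def \<phi>'_def by (intro GDERIV_along_line GDERIV_gradient diff)
  \<comment> \<open>The direction \<open>- g\<^sub>t\<close> enters the quadratic form twice, so its
    signs cancel and the second derivative is \<open>c\<close>.\<close>
  have "H\<^sub>v *v (- g\<^sub>t) = - (H\<^sub>v *v g\<^sub>t)"
    using matrix_vector_mult_scaleR[of H\<^sub>v "- 1" g\<^sub>t] by simp
  then have \<phi>': "(\<phi>' has_real_derivative c) (at 0)"
    using inner_gradient_along_line[OF diff(2),
        where x = \<theta> and t = 0 and v = "- g\<^sub>t" and w = "- g\<^sub>t"]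
    by (simp add: \<phi>'_def[abs_def] c_def assms(5))
  have \<phi>'0: "\<phi>' 0 = - (g\<^sub>t \<bullet> g\<^sub>v)"
    by (simp add: \<phi>'_def assms(3))
  have "((\<lambda>\<eta>. r \<eta> / \<eta>\<^sup>2) \<longlongrightarrow> 0) (at 0)"
    using taylor2_peano[OF always_eventually \<phi>'] \<phi> by (simp add: r_def)
  then have "((\<lambda>\<eta>. r \<eta> / \<eta>\<^sup>2) \<longlongrightarrow> 0) (at_right 0)"
    by (rule filterlim_mono) (auto simp: at_le)
  moreover have "L\<^sub>v (\<theta> - \<eta> *\<^sub>R g\<^sub>t) - L\<^sub>v \<theta>
      = - \<eta> * (g\<^sub>t \<bullet> g\<^sub>v) + \<eta>\<^sup>2 / 2 * (g\<^sub>t \<bullet> (H\<^sub>v *v g\<^sub>t)) + r \<eta>" for \<eta>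
    by (simp add: r_def \<phi>'0 c_def \<phi>_def)
  moreover have "\<forall>\<^sub>F \<eta> in at_right 0. L\<^sub>v (\<theta> - \<eta> *\<^sub>R g\<^sub>t) > L\<^sub>v \<theta>" if "g\<^sub>t \<bullet> g\<^sub>v < 0"
  proof -
    \<comment> \<open>The sign of the first derivative already decides this:
      \<open>\<phi>' 0\<close> is positive, so \<open>\<phi>\<close> exceeds \<open>\<phi> 0\<close>
      just to the right of 0.\<close>
    have "\<exists>d>0. \<forall>h>0. h < d \<longrightarrow> \<phi> 0 < \<phi> (0 + h)"
      using that \<phi>'0 by (intro DERIV_pos_inc_right[OF \<phi>]) simp
    then show ?thesis
      by (auto simp: eventually_at_right_field \<phi>_def)
  qed
  ultimately show ?thesis
    by blast
qed

end
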